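(* Let $T=(T_1,\dots,T_d)$ be a contractive $d$-tuple (not necessarily commuting) acting on an infinite dimensional Hilbert space $\mathcal{H}$ such that $\Delta_T=1$. Then the following are equivalent: (i) $T$ is maximal. (ii) There is no non-zero polynomial $P$ in $d$ non-commuting variables such that $P(T_1,\dots,T_d)|_{\mathcal{D}_1}=0$.
   Context: A $d$-tuple $T=(T_1,\dots,T_d)$ of bounded linear operators on a Hilbert space $\mathcal{H}$ is a contractive tuple (row contraction) if $\sum_{i=1}^d T_iT_i^*\le I_{\mathcal{H}}$. Define $\Psi_T:B(\mathcal{H})\to B(\mathcal{H})$ by $\Psi_T(X)=\sum_{i=1}^d T_iXT_i^*$. For $n\in\mathbb{N}=\{1,2,\dots\}$ the $n$-th defect space of $T$ is $\mathcal{D}_n:=\overline{\mathrm{ran}}(I-\Psi_T^n(I))\subseteq\mathcal{H}$ (closure of the range), and the $n$-th defect index is $\Delta_T^n:=\dim\mathcal{D}_n$ (the superscript $n$ is an index, not a power); $\Delta_T:=\Delta_T^1$. A contractive $d$-tuple $T$ with $\Delta_T<\infty$ on an infinite dimensional Hilbert space is called maximal if $\Delta_T^n=(1+d+\dots+d^{n-1})\Delta_T$ for all $n\in\mathbb{N}$. For a polynomial $P$ in $d$ non-commuting variables (an element of the free algebra over $\mathbb{C}$), $P(T_1,\dots,T_d)$ is obtained by substituting $T_i$ for the $i$-th variable. *)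

theory Defs
  imports "HOL-Analysis.Analysis" "HOL-Library.Extended_Nat" "HOL-Library.Poly_Mapping"
begin

text \<open>A complex Hilbert space: a real Hilbert space (for the real part of the inner product)
  together with a compatible complex scalar multiplication and a sesquilinear form that is
  linear in its first argument.  The norm, hence completeness and \<^term>\<open>closure\<close>, is that of
  the complex inner product because \<open>norm x ^ 2 = inner x x = Re (cinner x x) = cinner x x\<close>.\<close>

class complex_hilbert_space = real_inner + complete_space +
  fixes scaleC :: "complex \<Rightarrow> 'a \<Rightarrow> 'a" (infixr "*\<^sub>C" 75)
    and cinner :: "'a \<Rightarrow> 'a \<Rightarrow> complex"
  assumes scaleC_add_right: "c *\<^sub>C (x + y) = c *\<^sub>C x + c *\<^sub>C y"
    and scaleC_add_left: "(b + c) *\<^sub>C x = b *\<^sub>C x + c *\<^sub>C x"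
    and scaleC_scaleC: "b *\<^sub>C (c *\<^sub>C x) = (b * c) *\<^sub>C x"
    and scaleC_of_real: "complex_of_real r *\<^sub>C x = r *\<^sub>R x"
    and cinner_add_left: "cinner (x + y) z = cinner x z + cinner y z"
    and cinner_scaleC_left: "cinner (c *\<^sub>C x) y = c * cinner x y"
    and cinner_commute: "cinner x y = cnj (cinner y x)"
    and Re_cinner: "Re (cinner x y) = inner x y"

global_interpretation complex_vector:
  vector_space "scaleC :: complex \<Rightarrow> 'a::complex_hilbert_space \<Rightarrow> 'a"
  using scaleC_of_real[of 1]
  by unfold_locales (simp_all add: scaleC_add_right scaleC_add_left scaleC_scaleC)

definition finite_cdim :: "'a::complex_hilbert_space set \<Rightarrow> bool" where
  "finite_cdim S \<longleftrightarrow> (\<exists>B. finite B \<and> S \<subseteq> complex_vector.span B)"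

text \<open>All infinite dimensions are identified.  The case distinction is needed because
  \<^term>\<open>complex_vector.dim\<close> is a \<^term>\<open>card\<close> and so is 0 on infinite-dimensional subspaces.\<close>

definition cdim :: "'a::complex_hilbert_space set \<Rightarrow> enat" where
  "cdim S = (if finite_cdim S then enat (complex_vector.dim S) else \<infinity>)"

definition bounded_clinear ::
    "('a::complex_hilbert_space \<Rightarrow> 'b::complex_hilbert_space) \<Rightarrow> bool" where
  "bounded_clinear f \<longleftrightarrow> bounded_linear f \<and> (\<forall>c x. f (c *\<^sub>C x) = c *\<^sub>C f x)"

text \<open>As for \<^const>\<open>adjoint\<close>, the value is meaningful when an adjoint exists, in particular
  for every bounded complex-linear operator; it is then unique.\<close>

definition cadjoint ::
    "('a::complex_hilbert_space \<Rightarrow> 'b::complex_hilbert_space) \<Rightarrow> 'b \<Rightarrow> 'a" where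
  "cadjoint f = (SOME g. \<forall>x y. cinner (f x) y = cinner x (g y))"

definition op_le ::
    "('a::complex_hilbert_space \<Rightarrow> 'a) \<Rightarrow> ('a \<Rightarrow> 'a) \<Rightarrow> bool" where
  "op_le A B \<longleftrightarrow> (\<forall>x. cinner (B x - A x) x \<in> \<real>\<^sub>\<ge>\<^sub>0)"

definition Psi ::
    "('d::finite \<Rightarrow> 'a::complex_hilbert_space \<Rightarrow> 'a) \<Rightarrow> ('a \<Rightarrow> 'a) \<Rightarrow> 'a \<Rightarrow> 'a" where
  "Psi T X = (\<lambda>x. \<Sum>i\<in>UNIV. T i (X (cadjoint (T i) x)))"

definition contractive_tuple ::
    "('d::finite \<Rightarrow> 'a::complex_hilbert_space \<Rightarrow> 'a) \<Rightarrow> bool" where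
  "contractive_tuple T \<longleftrightarrow>
     (\<forall>i. bounded_clinear (T i)) \<and> op_le (\<lambda>x. \<Sum>i\<in>UNIV. T i (cadjoint (T i) x)) id"

definition defect_space ::
    "('d::finite \<Rightarrow> 'a::complex_hilbert_space \<Rightarrow> 'a) \<Rightarrow> nat \<Rightarrow> 'a set" where
  "defect_space T n = closure (range (\<lambda>x. x - (Psi T ^^ n) id x))"

definition defect_index ::
    "('d::finite \<Rightarrow> 'a::complex_hilbert_space \<Rightarrow> 'a) \<Rightarrow> nat \<Rightarrow> enat" where
  "defect_index T n = cdim (defect_space T n)"

definition maximal_tuple ::
    "('d::finite \<Rightarrow> 'a::complex_hilbert_space \<Rightarrow> 'a) \<Rightarrow> bool" where
  "maximal_tuple T \<longleftrightarrow>
     contractive_tuple T \<and> defect_index T 1 < \<infinity> \<and> \<not> finite_cdim (UNIV :: 'a set) \<and>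
     (\<forall>n\<ge>1. defect_index T n = enat (\<Sum>k<n. CARD('d) ^ k) * defect_index T 1)"

text \<open>Elements of the free algebra over the complex numbers on the variables \<open>'d\<close>: finitely
  supported complex-valued functions on words.  The word \<open>[i, j, \<dots>]\<close> is the monomial
  \<open>X\<^sub>i X\<^sub>j \<dots>\<close>, so it evaluates to \<open>T i \<circ> T j \<circ> \<dots>\<close> and the empty word to the identity.\<close>

type_synonym 'd nc_poly = "'d list \<Rightarrow>\<^sub>0 complex"

definition nc_poly_eval ::
    "('d \<Rightarrow> 'a::complex_hilbert_space \<Rightarrow> 'a) \<Rightarrow> 'd nc_poly \<Rightarrow> 'a \<Rightarrow> 'a" where
  "nc_poly_eval T P = (\<lambda>x. \<Sum>w\<in>Poly_Mapping.keys P. Poly_Mapping.lookup P w *\<^sub>C foldr T w x)"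

end

theory Submission
  imports Defs
begin

text \<open>Since \<open>I - \<Psi>(I)\<close> is positive of rank one, it is \<open>x \<mapsto> \<langle>x, u\<rangle> u\<close> for some \<open>u \<noteq> 0\<close>.  Telescoping
  gives \<open>I - \<Psi>\<^sup>n(I) = \<Sum>\<^bsub>|w| < n\<^esub> \<langle>\<cdot>, T\<^sub>w u\<rangle> T\<^sub>w u\<close>, the frame operator of the finite family
  \<open>(T\<^sub>w u)\<^bsub>|w| < n\<^esub>\<close>, whose range is the span of that family.  So the \<open>n\<close>-th defect index attains the
  number \<open>1 + d + \<dots> + d\<^bsup>n-1\<^esup>\<close> of words of length less than \<open>n\<close> exactly when no nonzero polynomial
  of degree less than \<open>n\<close> annihilates \<open>u\<close>, and \<open>u\<close> spans the first defect space.\<close>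

section \<open>Adjoints\<close>

text \<open>Needed for the existence of adjoints: \<open>cadjoint\<close> is a choice and carries no
  information until some adjoint is known to exist.\<close>

lemma riesz_representation_real:
  fixes f :: "'a::{real_inner,complete_space} \<Rightarrow> real"
  assumes "bounded_linear f"
  shows "\<exists>y. \<forall>x. f x = inner x y"
proof -
  interpret bounded_linear f by fact
  define \<phi> where "\<phi> x = inner x x - 2 * f x" for x
  obtain K where K: "\<And>x. norm (f x) \<le> norm x * K" using bounded by blast
  have lower: "- (K^2) \<le> \<phi> x" for x
  proof -
    have "2 * f x \<le> 2 * (norm x * K)" using K[of x] by simp
    also have "\<dots> \<le> (norm x)^2 + K^2" using sum_squares_bound[of "norm x" K] by simp
    finally show ?thesis by (simp add: \<phi>_def power2_norm_eq_inner)
  qed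
  \<comment> \<open>A minimizing sequence of \<open>\<phi>\<close> is Cauchy by the parallelogram law, and at a minimum the
    derivative of \<open>\<phi>\<close> vanishes, which says that the minimizer represents \<open>f\<close>.\<close>
  define m where "m = Inf (range \<phi>)"
  have bdd: "bdd_below (range \<phi>)" using lower by (auto intro: bdd_belowI[of _ "- (K^2)"])
  have m_le: "m \<le> \<phi> x" for x unfolding m_def by (rule cInf_lower[OF _ bdd]) auto
  have "\<exists>x. \<phi> x < m + inverse (real (Suc n))" for n
    using cInf_less_iff[OF _ bdd, of "m + inverse (real (Suc n))"] unfolding m_def by auto
  then obtain s where s: "\<And>n. \<phi> (s n) < m + inverse (real (Suc n))" by metis
  have par: "(norm (x - y))^2 \<le> 2 * (\<phi> x - m) + 2 * (\<phi> y - m)" for x y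
  proof -
    have "(norm (x - y))^2 = 2 * \<phi> x + 2 * \<phi> y - 4 * \<phi> ((1/2) *\<^sub>R (x + y))"
      by (simp add: \<phi>_def power2_norm_eq_inner add scaleR inner_add inner_diff inner_commute
          algebra_simps)
    then show ?thesis using m_le[of "(1/2) *\<^sub>R (x + y)"] by simp
  qed
  have "Cauchy s"
  proof (rule metric_CauchyI)
    fix e :: real assume "0 < e"
    then obtain N where N: "inverse (real (Suc N)) < e^2 / 4"
      using reals_Archimedean[of "e^2 / 4"] by auto
    have small: "\<phi> (s n) - m < e^2 / 4" if "N \<le> n" for n
    proof -
      have "inverse (real (Suc n)) \<le> inverse (real (Suc N))" using that by simp
      then show ?thesis using s[of n] N by linarith
    qed
    have "dist (s i) (s j) < e" if "N \<le> i" "N \<le> j" for i j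
    proof -
      have "(norm (s i - s j))^2 < e^2"
        by (rule le_less_trans[OF par]) (use small[OF that(1)] small[OF that(2)] in \<open>simp add: field_simps\<close>)
      then show ?thesis using \<open>0 < e\<close> by (simp add: dist_norm power2_less_imp_less)
    qed
    then show "\<exists>N. \<forall>i\<ge>N. \<forall>j\<ge>N. dist (s i) (s j) < e" by blast
  qed
  then obtain y where y: "s \<longlonglongrightarrow> y" using Cauchy_convergent_iff convergent_def by blast
  have "(\<lambda>n. \<phi> (s n)) \<longlonglongrightarrow> \<phi> y"
    unfolding \<phi>_def by (intro tendsto_intros y tendsto)
  moreover have "(\<lambda>n. m + inverse (real (Suc n))) \<longlonglongrightarrow> m"
    using tendsto_add[OF tendsto_const LIMSEQ_inverse_real_of_nat, of m] by simp
  ultimately have "\<phi> y \<le> m" using s by (meson LIMSEQ_le less_imp_le)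
  have "f x = inner x y" for x
  proof -
    have quad: "0 \<le> t^2 * inner x x + 2 * t * (inner x y - f x)" for t
    proof -
      have "\<phi> (y + t *\<^sub>R x) = \<phi> y + (t^2 * inner x x + 2 * t * (inner x y - f x))"
        by (simp add: \<phi>_def add scaleR inner_add inner_commute power2_eq_square algebra_simps)
      then show ?thesis using m_le[of "y + t *\<^sub>R x"] \<open>\<phi> y \<le> m\<close> by linarith
    qed
    define c where "c = inner x y - f x"
    \<comment> \<open>The added 1 keeps the denominator positive even for x = 0. At t = -(c / q) the
      quadratic equals -(c^2 / q) - (c / q)^2, so its nonnegativity forces c = 0.\<close>
    define q where "q = inner x x + 1"
    have "q > 0" by (simp add: q_def add_nonneg_pos)
    have "0 \<le> (c / q)^2 * (q - 1) - 2 * (c / q) * c"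
      using quad[of "- (c / q)"] unfolding c_def[symmetric] by (simp add: q_def)
    also have "\<dots> = - (c^2 / q) - (c / q)^2"
      using \<open>q > 0\<close> by (simp add: field_simps power2_eq_square)
    finally have "(c / q)^2 + c^2 / q \<le> 0" by linarith
    moreover have "c^2 / q \<ge> 0" "(c / q)^2 \<ge> 0" using \<open>q > 0\<close> by auto
    ultimately have "(c / q)^2 = 0" by linarith
    then show ?thesis using \<open>q > 0\<close> by (simp add: c_def)
  qed
  then show ?thesis by blast
qed

text \<open>Together with \<open>Re_cinner\<close> this recovers the complex form from the real one,
  so real identities that also hold for i x lift to \<open>cinner\<close>.\<close>

lemma Im_cinner: "Im (cinner x y) = - inner (\<i> *\<^sub>C x) (y::'a::complex_hilbert_space)"
  using Re_cinner[of "\<i> *\<^sub>C x" y] by (simp add: cinner_scaleC_left)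

text \<open>The real Riesz vectors also work for the complex form because f commutes with
  multiplication by i. This gives an adjoint, and the choice in \<open>cadjoint\<close> then picks
  one.\<close>

lemma cinner_cadjoint:
  fixes f :: "'a::complex_hilbert_space \<Rightarrow> 'b::complex_hilbert_space"
  assumes "bounded_clinear f"
  shows "cinner (f x) y = cinner x (cadjoint f y)"
proof -
  have bl: "bounded_linear f" and sc: "f (c *\<^sub>C x) = c *\<^sub>C f x" for c x
    using assms by (auto simp: bounded_clinear_def)
  have "\<exists>g. \<forall>x. inner (f x) y = inner x g" for y
    using riesz_representation_real[OF bounded_linear_compose[OF bounded_linear_inner_left bl], of y]
    by simp
  then obtain g where g: "\<And>x y. inner (f x) y = inner x (g y)" by metis
  have "cinner (f x) y = cinner x (g y)" for x y
    using g by (simp add: complex_eq_iff Re_cinner Im_cinner flip: sc)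
  then have "\<exists>g. \<forall>x y. cinner (f x) y = cinner x (g y)" by blast
  then have "\<forall>x y. cinner (f x) y = cinner x (cadjoint f y)"
    unfolding cadjoint_def by (rule someI_ex)
  then show ?thesis by blast
qed

section \<open>Sesquilinear calculus of the inner product\<close>

lemma cinner_zero_left [simp]: "cinner 0 (y::'a::complex_hilbert_space) = 0"
  using cinner_add_left[of 0 0 y] by simp

lemma cinner_minus_left [simp]: "cinner (- x) (y::'a::complex_hilbert_space) = - cinner x y"
  using cinner_add_left[of x "- x" y] by (simp add: eq_neg_iff_add_eq_0 add.commute)

lemma cinner_diff_left: "cinner (x - y) (z::'a::complex_hilbert_space) = cinner x z - cinner y z"
  using cinner_add_left[of x "- y" z] by simp

lemma cinner_sum_left:
  "cinner (\<Sum>i\<in>A. f i) (z::'a::complex_hilbert_space) = (\<Sum>i\<in>A. cinner (f i) z)"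
  by (induction A rule: infinite_finite_induct) (simp_all add: cinner_add_left)

lemma cinner_zero_right [simp]: "cinner (x::'a::complex_hilbert_space) 0 = 0"
  by (subst cinner_commute) simp

lemma cinner_add_right:
  "cinner (x::'a::complex_hilbert_space) (y + z) = cinner x y + cinner x z"
  by (simp add: cinner_commute[of x] cinner_add_left)

lemma cinner_diff_right:
  "cinner (x::'a::complex_hilbert_space) (y - z) = cinner x y - cinner x z"
  by (simp add: cinner_commute[of x] cinner_diff_left)

lemma cinner_scaleC_right:
  "cinner (x::'a::complex_hilbert_space) (c *\<^sub>C y) = cnj c * cinner x y"
  by (simp add: cinner_commute[of x] cinner_scaleC_left)

lemma cinner_sum_right:
  "cinner (x::'a::complex_hilbert_space) (\<Sum>i\<in>A. f i) = (\<Sum>i\<in>A. cinner x (f i))"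
  by (simp add: cinner_commute[of x] cinner_sum_left)

lemma cinner_self: "cinner x (x::'a::complex_hilbert_space) = complex_of_real ((norm x)^2)"
proof -
  have "Im (cinner x x) = 0" using arg_cong[OF cinner_commute[of x x], of Im] by simp
  then show ?thesis by (simp add: complex_eq_iff Re_cinner power2_norm_eq_inner)
qed

lemma cinner_self_eq_0 [simp]: "cinner x x = 0 \<longleftrightarrow> x = (0::'a::complex_hilbert_space)"
  by (simp add: cinner_self)

lemma cinner_ext:
  fixes x y :: "'a::complex_hilbert_space"
  assumes "\<And>z. cinner z x = cinner z y"
  shows "x = y"
proof -
  have "cinner (x - y) (x - y) = 0" using assms[of "x - y"] by (simp add: cinner_diff_right)
  then show ?thesis by simp
qed

section \<open>Finite-dimensional subspaces\<close>

text \<open>Gram-Schmidt without normalization: the new vector b is replaced by its component u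
  orthogonal to the old span, and the approximant q of x is corrected by a multiple of u.\<close>

lemma orthogonal_decomposition_span:
  fixes B :: "'a::complex_hilbert_space set"
  assumes "finite B"
  shows "\<exists>m\<in>complex_vector.span B. \<forall>y\<in>complex_vector.span B. cinner y (x - m) = 0"
  using assms
proof (induction B arbitrary: x rule: finite_induct)
  case empty
  then show ?case by simp
next
  case (insert b B)
  obtain p where p: "p \<in> complex_vector.span B"
      "\<And>y. y \<in> complex_vector.span B \<Longrightarrow> cinner y (b - p) = 0"
    using insert.IH[of b] by blast
  obtain q where q: "q \<in> complex_vector.span B"
      "\<And>y. y \<in> complex_vector.span B \<Longrightarrow> cinner y (x - q) = 0"
    using insert.IH[of x] by blast
  define u where "u = b - p"
  \<comment> \<open>If u = 0, that is, if b already lies in the old span, division by zero yields c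
    = 0 and the next identity still holds.\<close>
  define c where "c = cinner (x - q) u / cinner u u"
  have c: "cinner (x - q) u = c * cinner u u" by (cases "u = 0") (simp_all add: c_def)
  then have c': "cinner u (x - q) = cnj c * cinner u u"
    by (metis cinner_commute complex_cnj_mult)
  have sub: "y \<in> complex_vector.span (insert b B)" if "y \<in> complex_vector.span B" for y
    using that complex_vector.span_mono[of B "insert b B"] by blast
  have "u \<in> complex_vector.span (insert b B)"
    unfolding u_def by (intro complex_vector.span_diff sub p(1) complex_vector.span_base) simp
  then have "q + c *\<^sub>C u \<in> complex_vector.span (insert b B)"
    by (intro complex_vector.span_add complex_vector.span_scale) (auto intro: sub q(1))
  moreover have "cinner y (x - (q + c *\<^sub>C u)) = 0" if y: "y \<in> complex_vector.span (insert b B)" for y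
  proof -
    obtain k where k: "y - k *\<^sub>C b \<in> complex_vector.span B"
      using y by (auto simp: complex_vector.span_insert)
    define z where "z = y - k *\<^sub>C u"
    have "z = (y - k *\<^sub>C b) + k *\<^sub>C p"
      by (simp add: z_def u_def complex_vector.scale_right_diff_distrib)
    then have z: "z \<in> complex_vector.span B"
      using k p(1) by (simp add: complex_vector.span_add complex_vector.span_scale)
    have y_eq: "y = z + k *\<^sub>C u" by (simp add: z_def)
    have "cinner z u = 0" "cinner z (x - q) = 0" using p(2) q(2) z by (auto simp: u_def)
    then show ?thesis
      unfolding y_eq diff_diff_eq[symmetric] cinner_diff_right[of _ "x - q"]
      by (simp add: cinner_add_left cinner_scaleC_left cinner_scaleC_right c')
  qed
  ultimately show ?case by blast
qed

lemma subspace_finite_cdim_eq_span: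
  fixes M :: "'a::complex_hilbert_space set"
  assumes "complex_vector.subspace M" "finite_cdim M"
  obtains B where "finite B" "complex_vector.independent B" "M = complex_vector.span B"
    "card B = complex_vector.dim M"
proof -
  obtain F where F: "finite F" "M \<subseteq> complex_vector.span F" using assms(2) by (auto simp: finite_cdim_def)
  obtain B where B: "B \<subseteq> M" "complex_vector.independent B" "M \<subseteq> complex_vector.span B"
    "card B = complex_vector.dim M" using complex_vector.basis_exists by blast
  have "finite B" using complex_vector.independent_span_bound[OF F(1) B(2)] B(1) F(2) by blast
  moreover have "M = complex_vector.span B"
    using B complex_vector.span_minimal[OF B(1) assms(1)] by blast
  ultimately show thesis using that B by blast
qed

lemma orthogonal_decomposition:
  fixes M :: "'a::complex_hilbert_space set"
  assumes "complex_vector.subspace M" "finite_cdim M"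
  obtains m where "m \<in> M" "\<And>y. y \<in> M \<Longrightarrow> cinner y (x - m) = 0"
  by (metis orthogonal_decomposition_span subspace_finite_cdim_eq_span[OF assms])

text \<open>For a limit x of points of M, the residual x - m is orthogonal to every s n - m, hence
  in the limit to itself. This disposes of the closure in \<open>defect_space\<close>.\<close>

lemma closed_finite_cdim_subspace:
  fixes M :: "'a::complex_hilbert_space set"
  assumes "complex_vector.subspace M" "finite_cdim M"
  shows "closed M"
proof -
  have "x \<in> M" if "s \<longlonglongrightarrow> x" "\<And>n. s n \<in> M" for s x
  proof -
    obtain m where m: "m \<in> M" "\<And>y. y \<in> M \<Longrightarrow> cinner y (x - m) = 0"
      using orthogonal_decomposition[OF assms] by blast
    have "inner (s n - m) (x - m) = 0" for n
      using m(2)[of "s n - m"] m(1) that(2) complex_vector.subspace_diff[OF assms(1)]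
      by (metis Re_cinner zero_complex.sel(1))
    moreover have "(\<lambda>n. inner (s n - m) (x - m)) \<longlonglongrightarrow> inner (x - m) (x - m)"
      by (intro tendsto_intros that(1))
    ultimately have "inner (x - m) (x - m) = 0"
      by (simp only: LIMSEQ_const_iff)
    then show ?thesis using m(1) by simp
  qed
  then show ?thesis unfolding closed_sequential_limits by blast
qed

text \<open>The range R is finite-dimensional, so each f v splits along R, and positivity of the
  operator kills the component orthogonal to R. The family may be linearly dependent, so the lemma
  applies before anything is known about maximality.\<close>

lemma range_frame_operator:
  fixes f :: "'w \<Rightarrow> 'a::complex_hilbert_space"
  assumes "finite W"
  shows "range (\<lambda>x. \<Sum>w\<in>W. cinner x (f w) *\<^sub>C f w) = complex_vector.span (f ` W)"
    (is "range ?S = ?M")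
proof
  show sub: "range ?S \<subseteq> ?M"
    by (auto intro!: complex_vector.span_sum complex_vector.span_scale
        intro: complex_vector.span_base)
  have add: "?S x + ?S y = ?S (x + y)" and scale: "c *\<^sub>C ?S x = ?S (c *\<^sub>C x)" for x y c
    by (simp_all add: cinner_add_left cinner_scaleC_left complex_vector.scale_left_distrib
        sum.distrib complex_vector.scale_sum_right)
  have R: "complex_vector.subspace (range ?S)"
  proof (rule complex_vector.subspaceI)
    show "0 \<in> range ?S" by (rule range_eqI[of _ _ 0]) simp
  qed (auto simp only: add scale intro: rangeI)
  have fin: "finite_cdim (range ?S)"
    unfolding finite_cdim_def using sub assms by (intro exI[of _ "f ` W"]) auto
  have "f v \<in> range ?S" if v: "v \<in> W" for v
  proof -
    obtain r where r: "r \<in> range ?S" "\<And>y. y \<in> range ?S \<Longrightarrow> cinner y (f v - r) = 0"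
      using orthogonal_decomposition[OF R fin] by blast
    \<comment> \<open>\<open>u\<close> is orthogonal to \<open>?S u\<close>, hence to all \<open>f w\<close>.\<close>
    define u where "u = f v - r"
    have "0 = cinner (?S u) u" using r(2) by (simp add: u_def)
    also have "\<dots> = (\<Sum>w\<in>W. complex_of_real ((cmod (cinner u (f w)))^2))"
      by (simp add: cinner_sum_left cinner_scaleC_left cinner_commute[of "f _" u]
          complex_norm_square[symmetric] del: of_real_power)
    also have "\<dots> = complex_of_real (\<Sum>w\<in>W. (cmod (cinner u (f w)))^2)" by simp
    finally have "(\<Sum>w\<in>W. (cmod (cinner u (f w)))^2) = 0" by (metis of_real_eq_0_iff)
    then have "cinner u (f v) = 0" using v assms by (simp add: sum_nonneg_eq_0_iff)
    moreover have "cinner u r = 0" using r cinner_commute[of u r] by (simp add: u_def)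
    ultimately have "cinner u (f v - r) = 0" by (simp add: cinner_diff_right)
    then have "u = 0" by (simp only: cinner_self_eq_0 flip: u_def)
    then show ?thesis using r(1) by (simp add: u_def)
  qed
  then show "?M \<subseteq> range ?S" by (intro complex_vector.span_minimal R) blast
qed

section \<open>Defect spaces\<close>

lemma contractive_tuple_bounded_clinear:
  "contractive_tuple T \<Longrightarrow> bounded_clinear (T i)"
  by (simp add: contractive_tuple_def)

lemma bounded_clinear_linear_combination:
  assumes "bounded_clinear f"
  shows "f (\<Sum>w\<in>W. c w *\<^sub>C g w) = (\<Sum>w\<in>W. c w *\<^sub>C f (g w))"
proof -
  have bl: "bounded_linear f" and sc: "f (c *\<^sub>C x) = c *\<^sub>C f x" for c x
    using assms by (auto simp: bounded_clinear_def)
  interpret bounded_linear f by (rule bl)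
  show ?thesis by (simp add: sum sc)
qed

lemma foldr_scaleC:
  assumes "contractive_tuple T"
  shows "foldr T w (c *\<^sub>C x) = c *\<^sub>C foldr T w x"
  using contractive_tuple_bounded_clinear[OF assms]
  by (induction w) (auto simp: bounded_clinear_def)

lemma defect_operator_selfadjoint:
  fixes T :: "'d::finite \<Rightarrow> 'a::complex_hilbert_space \<Rightarrow> 'a"
  assumes "contractive_tuple T"
  shows "cinner (x - Psi T id x) y = cinner x (y - Psi T id y)"
proof -
  note adj = cinner_cadjoint[OF contractive_tuple_bounded_clinear[OF assms]]
  have adj': "cinner a (T i b) = cinner (cadjoint (T i) a) b" for a b i
    using adj[of i b a] by (metis cinner_commute)
  show ?thesis
    by (simp add: Psi_def cinner_diff_left cinner_diff_right cinner_sum_left cinner_sum_right adj adj')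
qed

lemma defect_space_1_closure:
  "defect_space T 1 = closure (range (\<lambda>x. x - Psi T id x))"
  by (simp only: defect_space_def One_nat_def funpow.simps o_apply id_apply)

text \<open>On a line spanned by v, self-adjointness leaves only multiples of x -> <x, v> v.
  Contractivity makes the factor real and nonnegative, rank one makes it nonzero, and its square
  root is absorbed into the vector.\<close>

lemma rank_one_defect_operator:
  fixes T :: "'d::finite \<Rightarrow> 'a::complex_hilbert_space \<Rightarrow> 'a"
  assumes T: "contractive_tuple T" and "defect_index T 1 = 1"
  obtains u where "u \<noteq> 0" "\<And>x. x - Psi T id x = cinner x u *\<^sub>C u"
proof -
  define D where "D x = x - Psi T id x" for x
  have sa: "cinner (D x) y = cinner x (D y)" for x y
    unfolding D_def by (rule defect_operator_selfadjoint[OF T])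
  \<comment> \<open>Linearity of D is read off from the symmetry \<open>sa\<close>, by moving D to
    the other side of the inner product.\<close>
  have add: "D x + D y = D (x + y)" for x y
    by (rule cinner_ext) (simp add: sa[symmetric] cinner_add_right)
  have scale: "c *\<^sub>C D x = D (c *\<^sub>C x)" for c x
    by (rule cinner_ext) (simp add: sa[symmetric] cinner_scaleC_right)
  have zero: "D 0 = 0"
    using scale[of 0 0] by simp
  have R: "complex_vector.subspace (range D)"
  proof (rule complex_vector.subspaceI)
    show "0 \<in> range D" using zero by (metis rangeI)
  qed (use add scale in blast)+
  have dsp: "defect_space T 1 = closure (range D)"
    unfolding defect_space_1_closure D_def ..
  have cd: "cdim (closure (range D)) = 1" using assms(2) unfolding defect_index_def dsp .
  \<comment> \<open>Dimension 1 excludes the infinite branch of \<open>cdim\<close>. Finite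
    dimension then passes to the range itself, which is therefore closed.\<close>
  then have "finite_cdim (closure (range D))" by (auto simp: cdim_def split: if_splits)
  then have fin: "finite_cdim (range D)"
    unfolding finite_cdim_def using closure_subset by blast
  then have "closure (range D) = range D" using closed_finite_cdim_subspace[OF R] by simp
  with cd fin have dim1: "complex_vector.dim (range D) = 1"
    by (simp add: cdim_def one_enat_def)
  obtain B where B: "complex_vector.independent B" "range D = complex_vector.span B" "card B = 1"
    using subspace_finite_cdim_eq_span[OF R fin] dim1 by metis
  then obtain v where v: "B = {v}" by (auto simp: card_1_singleton_iff)
  have "v \<noteq> 0" using B(1) v complex_vector.dependent_zero by blast
  have span: "range D = range (\<lambda>k. k *\<^sub>C v)"
    using B(2) v by (simp add: complex_vector.span_singleton)
  then have "\<exists>k. D x = k *\<^sub>C v" for x by blast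
  then obtain a where a: "\<And>x. D x = a x *\<^sub>C v" by metis
  define n where "n = (norm v)^2"
  have "n > 0" using \<open>v \<noteq> 0\<close> by (simp add: n_def)
  have vv: "cinner v v = complex_of_real n" by (simp add: n_def cinner_self)
  have eq: "a x * complex_of_real n = cnj (a v) * cinner x v" for x
    using sa[of x v] by (simp add: a cinner_scaleC_left cinner_scaleC_right vv)
  have "cinner (D v) v \<in> \<real>\<^sub>\<ge>\<^sub>0"
    using T by (auto simp: contractive_tuple_def op_le_def D_def Psi_def)
  then obtain r where r: "a v * complex_of_real n = complex_of_real r" "r \<ge> 0"
    by (auto simp: a cinner_scaleC_left vv nonneg_Reals_def)
  \<comment> \<open>The eigenvalue of D at v: D v = b v.\<close>
  define b where "b = r / n"
  have av: "a v = complex_of_real b" using r(1) \<open>n > 0\<close> by (simp add: b_def field_simps)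
  have "b \<noteq> 0"
  proof
    assume "b = 0"
    then have "a x = 0" for x using eq[of x] av \<open>n > 0\<close> by simp
    then have "D x = 0" for x by (simp add: a)
    moreover have "v \<in> range D" using B(2) v complex_vector.span_base by auto
    ultimately show False using \<open>v \<noteq> 0\<close> by auto
  qed
  then have "b > 0" using r(2) \<open>n > 0\<close> by (simp add: b_def)
  \<comment> \<open>Chosen so that <x, s v> s v = (b / n) <x, v> v, which is D x.\<close>
  define s where "s = sqrt (b / n)"
  have s: "s \<noteq> 0" "s * s = b / n" using \<open>b > 0\<close> \<open>n > 0\<close> by (auto simp: s_def)
  define u where "u = complex_of_real s *\<^sub>C v"
  have "u \<noteq> 0" using s(1) \<open>v \<noteq> 0\<close> by (simp add: u_def)
  moreover have "x - Psi T id x = cinner x u *\<^sub>C u" for x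
  proof -
    have "a x = complex_of_real (b / n) * cinner x v"
      using eq[of x] \<open>n > 0\<close> by (simp add: av field_simps)
    then have "a x = cinner x u * complex_of_real s"
      by (simp add: u_def cinner_scaleC_right s(2)[symmetric])
    then show ?thesis using a[of x] by (simp add: D_def u_def complex_vector.scale_scale)
  qed
  ultimately show thesis by (rule that)
qed

section \<open>Words of bounded length\<close>

lemma words_length_less_Suc:
  "{w :: 'd list. length w < Suc n} = insert [] ((\<lambda>(i, w). i # w) ` (UNIV \<times> {w. length w < n}))"
  (is "?L = ?R")
proof (rule set_eqI)
  show "w \<in> ?L \<longleftrightarrow> w \<in> ?R" for w by (cases w) (auto simp: image_iff)
qed

lemma finite_words_length_less: "finite {w :: 'd::finite list. length w < n}"
  using finite_lists_length_le[of "UNIV :: 'd set" n]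
  by (rule rev_finite_subset) auto

text \<open>Splitting off the first letter matches \<open>foldr\<close>, where that letter is the
  outermost operator.\<close>

lemma sum_words_length_less_Suc:
  "(\<Sum>w | length w < Suc n. g w)
    = g [] + (\<Sum>i\<in>UNIV. \<Sum>w | length w < n. g ((i::'d::finite) # w))"
proof -
  have "(\<Sum>w | length w < Suc n. g w)
      = g [] + (\<Sum>w\<in>(\<lambda>(i, w). i # w) ` (UNIV \<times> {w. length w < n}). g w)"
    unfolding words_length_less_Suc
    by (rule sum.insert)
      (intro finite_imageI finite_cartesian_product finite_words_length_less finite, auto)
  also have "(\<Sum>w\<in>(\<lambda>(i, w). i # w) ` (UNIV \<times> {w. length w < n}). g w)
      = (\<Sum>(i, w)\<in>UNIV \<times> {w. length w < n}. g (i # w))"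
    by (subst sum.reindex) (auto simp: inj_on_def case_prod_unfold)
  also have "\<dots> = (\<Sum>i\<in>UNIV. \<Sum>w | length w < n. g (i # w))"
    by (simp add: sum.cartesian_product)
  finally show ?thesis .
qed

lemma card_words_length_less:
  "card {w :: 'd list. length w < n} = (\<Sum>k<n. CARD('d::finite) ^ k)"
proof (induction n)
  case (Suc n)
  have "card {w :: 'd list. length w < Suc n} = Suc (CARD('d) * card {w :: 'd list. length w < n})"
    using sum_words_length_less_Suc[where g = "\<lambda>_ :: 'd list. 1::nat" and n = n] by simp
  also have "\<dots> = (\<Sum>k<Suc n. CARD('d) ^ k)"
    by (simp add: Suc.IH sum.lessThan_Suc_shift sum_distrib_left del: sum.lessThan_Suc)
  finally show ?case .
qed simp

text \<open>Induction on n through I - Psi^(n+1)(I) = (I - Psi(I)) + Psi(I - Psi^n(I)). The first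
  summand is the term of the empty word, and conjugation by T_i turns <., g> g into <., T_i g> T_i
  g, which prepends the letter i.\<close>

lemma iterated_defect_operator:
  fixes T :: "'d::finite \<Rightarrow> 'a::complex_hilbert_space \<Rightarrow> 'a"
  assumes T: "contractive_tuple T" and u: "\<And>x. x - Psi T id x = cinner x u *\<^sub>C u"
  shows "x - (Psi T ^^ n) id x = (\<Sum>w | length w < n. cinner x (foldr T w u) *\<^sub>C foldr T w u)"
proof (induction n arbitrary: x)
  case 0
  then show ?case by simp
next
  case (Suc n)
  define f where "f w = foldr T w u" for w
  note bc = contractive_tuple_bounded_clinear[OF T]
  have adj: "cinner (cadjoint (T i) a) b = cinner a (T i b)" for a b i
    using cinner_cadjoint[OF bc, of i b a] by (metis cinner_commute)
  have Tdiff: "T i (a - b) = T i a - T i b" for i a b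
    using bc[of i] by (simp add: bounded_clinear_def bounded_linear.linear linear_diff)
  have step: "T i (cadjoint (T i) x) - T i ((Psi T ^^ n) id (cadjoint (T i) x))
      = (\<Sum>w | length w < n. cinner x (f (i # w)) *\<^sub>C f (i # w))" for i
    unfolding Tdiff[symmetric] Suc.IH bounded_clinear_linear_combination[OF bc]
    by (simp add: adj f_def)
  have "x - (Psi T ^^ Suc n) id x = (x - Psi T id x)
      + (\<Sum>i\<in>UNIV. T i (cadjoint (T i) x) - T i ((Psi T ^^ n) id (cadjoint (T i) x)))"
    by (simp add: Psi_def sum_subtractf)
  also have "\<dots> = (\<Sum>w | length w < Suc n. cinner x (f w) *\<^sub>C f w)"
    unfolding step sum_words_length_less_Suc by (simp add: u f_def)
  finally show ?case unfolding f_def .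
qed

lemma defect_space_eq_span:
  fixes T :: "'d::finite \<Rightarrow> 'a::complex_hilbert_space \<Rightarrow> 'a"
  assumes T: "contractive_tuple T" and u: "\<And>x. x - Psi T id x = cinner x u *\<^sub>C u"
  shows "defect_space T n = complex_vector.span ((\<lambda>w. foldr T w u) ` {w. length w < n})"
proof -
  let ?M = "complex_vector.span ((\<lambda>w. foldr T w u) ` {w. length w < n})"
  have "range (\<lambda>x. x - (Psi T ^^ n) id x) = ?M"
    unfolding iterated_defect_operator[OF assms]
    by (rule range_frame_operator[OF finite_words_length_less])
  moreover have "closed ?M"
    by (intro closed_finite_cdim_subspace complex_vector.subspace_span)
      (unfold finite_cdim_def, use finite_words_length_less in blast)
  ultimately show ?thesis by (simp add: defect_space_def)
qed

section \<open>Linear independence of a family\<close>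

lemma (in vector_space) dim_span_image_eq_card_iff:
  assumes "finite W"
  shows "dim (span (f ` W)) = card W \<longleftrightarrow> inj_on f W \<and> independent (f ` W)"
proof
  assume eq: "dim (span (f ` W)) = card W"
  have "dim (span (f ` W)) \<le> card (f ` W)" using assms by (intro dim_le_card) auto
  then have card: "card (f ` W) = card W" using eq card_image_le[OF assms, of f] by linarith
  have "independent (f ` W)"
  proof
    assume "dependent (f ` W)"
    then obtain v where v: "v \<in> f ` W" "v \<in> span (f ` W - {v})" by (auto simp: dependent_def)
    then have "span (f ` W) = span (f ` W - {v})"
      using span_redundant[OF v(2)] by (simp add: insert_absorb)
    then have "dim (span (f ` W)) \<le> card (f ` W - {v})" using assms by (intro dim_le_card) auto
    moreover have "card (f ` W - {v}) < card (f ` W)"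
      using v(1) assms by (intro psubset_card_mono) auto
    ultimately show False using eq card by simp
  qed
  then show "inj_on f W \<and> independent (f ` W)" using card assms by (simp add: inj_on_iff_eq_card)
qed (simp add: dim_eq_card_independent card_image)

lemma (in vector_space) inj_independent_family_iff:
  assumes "finite W"
  shows "inj_on f W \<and> independent (f ` W) \<longleftrightarrow>
    (\<forall>c. (\<Sum>w\<in>W. scale (c w) (f w)) = 0 \<longrightarrow> (\<forall>w\<in>W. c w = 0))"
proof (intro iffI allI impI ballI; (elim conjE)?)
  fix c w
  assume inj: "inj_on f W" and ind: "independent (f ` W)"
    and 0: "(\<Sum>w\<in>W. scale (c w) (f w)) = 0" and w: "w \<in> W"
  have "(\<Sum>v\<in>f ` W. scale (c (the_inv_into W f v)) v) = 0"
    using 0 by (simp add: sum.reindex[OF inj] the_inv_into_f_f[OF inj])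
  then have "c (the_inv_into W f (f w)) = 0"
    using independentD[OF ind _ order_refl, of "\<lambda>v. c (the_inv_into W f v)" "f w"] assms w by simp
  then show "c w = 0" using w by (simp add: the_inv_into_f_f[OF inj])
next
  assume *: "\<forall>c. (\<Sum>w\<in>W. scale (c w) (f w)) = 0 \<longrightarrow> (\<forall>w\<in>W. c w = 0)"
  have inj: "inj_on f W"
  proof (rule inj_onI, rule ccontr)
    fix a b assume ab: "a \<in> W" "b \<in> W" "f a = f b" "a \<noteq> b"
    \<comment> \<open>A repeated vector gives the nontrivial relation f a - f b = 0.\<close>
    let ?c = "\<lambda>w. if w = a then 1 else if w = b then - 1 else 0 :: 'a"
    have "(\<Sum>w\<in>W. scale (?c w) (f w)) = (\<Sum>w\<in>{a, b}. scale (?c w) (f w))"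
      using ab assms by (intro sum.mono_neutral_right) auto
    then have "(\<Sum>w\<in>W. scale (?c w) (f w)) = 0" using ab by simp
    from *[rule_format, OF this ab(1)] show False by simp
  qed
  moreover have "independent (f ` W)"
    unfolding independent_explicit_finite_subsets
  proof (intro allI impI ballI)
    fix S u v
    assume S: "S \<subseteq> f ` W" "finite S" and 0: "(\<Sum>v\<in>S. scale (u v) v) = 0" and v: "v \<in> S"
    \<comment> \<open>A relation on S becomes one on all of W by pulling back along f and extending
      by zero.\<close>
    let ?c = "\<lambda>w. if f w \<in> S then u (f w) else 0"
    have "(\<Sum>w\<in>W. scale (?c w) (f w)) = (\<Sum>v\<in>f ` W. scale (if v \<in> S then u v else 0) v)"
      by (simp add: sum.reindex[OF inj])
    also have "\<dots> = (\<Sum>v\<in>S. scale (if v \<in> S then u v else 0) v)"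
      using S assms by (intro sum.mono_neutral_right) auto
    also have "\<dots> = 0" using 0 by simp
    finally have c0: "(\<Sum>w\<in>W. scale (?c w) (f w)) = 0" .
    obtain w where "w \<in> W" "v = f w" using S v by blast
    then show "u v = 0" using *[rule_format, OF c0, of w] v by simp
  qed
  ultimately show "inj_on f W \<and> independent (f ` W)" ..
qed

section \<open>From dimension counts to annihilating polynomials\<close>

theorem theorem3p4:
  fixes T :: "'d::finite \<Rightarrow> 'a::complex_hilbert_space \<Rightarrow> 'a"
  assumes "contractive_tuple T"
    and "\<not> finite_cdim (UNIV :: 'a set)"
    and "defect_index T 1 = 1"
  shows "maximal_tuple T \<longleftrightarrow>
    \<not> (\<exists>P :: 'd nc_poly. P \<noteq> 0 \<and> (\<forall>x\<in>defect_space T 1. nc_poly_eval T P x = 0))"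
proof -
  note T = assms(1)
  obtain u where "u \<noteq> 0" and u: "\<And>x. x - Psi T id x = cinner x u *\<^sub>C u"
    using rank_one_defect_operator[OF T assms(3)] by blast
  define f where "f w = foldr T w u" for w
  define W where "W n = {w :: 'd list. length w < n}" for n
  have finW: "finite (W n)" for n by (simp add: W_def finite_words_length_less)
  have D: "defect_space T n = complex_vector.span (f ` W n)" for n
    unfolding defect_space_eq_span[OF T u] f_def W_def ..
  have "W 1 = {[]}" by (auto simp: W_def)
  then have D1: "defect_space T 1 = range (\<lambda>k. k *\<^sub>C u)"
    by (simp add: D f_def complex_vector.span_singleton)
  have eval: "nc_poly_eval T P (k *\<^sub>C u) = k *\<^sub>C nc_poly_eval T P u" for P k
    by (simp add: nc_poly_eval_def foldr_scaleC[OF T] complex_vector.scale_sum_right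
        mult.commute complex_vector.scale_scale)
  \<comment> \<open>The first defect space is the line through u and evaluation is homogeneous, so
    testing at u suffices; k = 1 shows that u lies on the line.\<close>
  have vanish: "(\<forall>x\<in>defect_space T 1. nc_poly_eval T P x = 0) \<longleftrightarrow> nc_poly_eval T P u = 0" for P
    using eval[of P 1] unfolding D1 by (auto simp: eval)
  \<comment> \<open>Coefficients outside the support vanish, so the sum may run over all words
    shorter than n, an index set independent of P.\<close>
  have eval_W: "nc_poly_eval T P u = (\<Sum>w\<in>W n. Poly_Mapping.lookup P w *\<^sub>C f w)"
    if "Poly_Mapping.keys P \<subseteq> W n" for P n
    unfolding nc_poly_eval_def f_def using that finW
    by (intro sum.mono_neutral_left) (auto simp: in_keys_iff)
  have index: "defect_index T n = enat (complex_vector.dim (complex_vector.span (f ` W n)))" for n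
  proof -
    have "finite_cdim (defect_space T n)"
      unfolding finite_cdim_def D using finW by blast
    then show ?thesis by (simp add: defect_index_def cdim_def D)
  qed
  \<comment> \<open>The other clauses of \<open>maximal_tuple\<close> hold by assumption, the factor
    \<open>defect_index T 1\<close> is 1, and the geometric sum counts the words in
    \<open>W n\<close>.\<close>
  have "maximal_tuple T \<longleftrightarrow>
      (\<forall>n\<ge>1. complex_vector.dim (complex_vector.span (f ` W n)) = card (W n))"
    using assms(1,2)
    by (simp only: maximal_tuple_def assms(3), simp add: index W_def card_words_length_less one_enat_def)
  also have "\<dots> \<longleftrightarrow> (\<forall>n\<ge>1. \<forall>c. (\<Sum>w\<in>W n. c w *\<^sub>C f w) = 0 \<longrightarrow> (\<forall>w\<in>W n. c w = 0))"
    by (simp only: complex_vector.dim_span_image_eq_card_iff[OF finW]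
        complex_vector.inj_independent_family_iff[OF finW])
  also have "\<dots> \<longleftrightarrow> \<not> (\<exists>P. P \<noteq> 0 \<and> nc_poly_eval T P u = 0)"
  proof (intro iffI notI allI impI ballI; (elim exE conjE)?)
    fix P :: "'d nc_poly"
    assume *: "\<forall>n\<ge>1. \<forall>c. (\<Sum>w\<in>W n. c w *\<^sub>C f w) = 0 \<longrightarrow> (\<forall>w\<in>W n. c w = 0)"
      and P: "P \<noteq> 0" "nc_poly_eval T P u = 0"
    \<comment> \<open>The successor is there because \<open>W n\<close> bounds lengths strictly; it
      also ensures n >= 1.\<close>
    define n where "n = Suc (Max (length ` Poly_Mapping.keys P))"
    have keys: "Poly_Mapping.keys P \<subseteq> W n" by (auto simp: W_def n_def less_Suc_eq_le)
    have "n \<ge> 1" by (simp add: n_def)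
    moreover have "(\<Sum>w\<in>W n. Poly_Mapping.lookup P w *\<^sub>C f w) = 0"
      using eval_W[OF keys] P(2) by simp
    ultimately have "Poly_Mapping.lookup P w = 0" if "w \<in> W n" for w
      using *[rule_format, of n "Poly_Mapping.lookup P" w] that by simp
    then have "Poly_Mapping.keys P = {}" using keys by (auto simp: in_keys_iff simp del: keys_eq_empty)
    then show False using P(1) by simp
  next
    fix n c w
    assume no: "\<not> (\<exists>P. P \<noteq> 0 \<and> nc_poly_eval T P u = 0)"
      and c: "(\<Sum>w\<in>W n. c w *\<^sub>C f w) = 0" and w: "w \<in> W n"
    \<comment> \<open>The coefficients c are arbitrary off \<open>W n\<close>, so they are cut off
      there to obtain finite support.\<close>
    define P where "P = Abs_poly_mapping (\<lambda>w. if w \<in> W n then c w else 0)"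
    have P: "Poly_Mapping.lookup P v = (if v \<in> W n then c v else 0)" for v
      unfolding P_def using finW[of n] by (subst lookup_Abs_poly_mapping) auto
    have "Poly_Mapping.keys P \<subseteq> W n" by (auto simp: in_keys_iff P split: if_splits)
    from eval_W[OF this] have "nc_poly_eval T P u = 0" using c by (simp add: P)
    then have "P = 0" using no by blast
    then show "c w = 0" using P[of w] w by simp
  qed
  finally show ?thesis by (simp only: vanish)
qed

end
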